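(* Let $(X,f)$ and $(Y,g)$ be set-function pairs (with $f:X\times X\to\mathbb{R}$, $g:Y\times Y\to\mathbb{R}$ arbitrary functions) with preorder filtrations $\mathcal{O}(X,f)$ and $\mathcal{O}(Y,g)$, and let $k\ge0$ be an integer. Let $P^X$ and $P^Y$ be the $k$-th dimensional (ordered tuple) persistence modules of $\mathcal{O}(X,f)$ and $\mathcal{O}(Y,g)$ respectively. Then $$d_{int}(P^X,P^Y)\le 2\,d_{CD}((X,f),(Y,g)).$$
   Context: Fix a field $\mathbb{F}$. A set-function pair $(X,f)$ is a set $X$ with a function $f:X\times X\to\mathbb{R}$. A correspondence between $X$ and $Y$ is a subset $\mathcal{M}\subset X\times Y$ such that every $x\in X$ has some $y\in Y$ with $(x,y)\in\mathcal{M}$ and every $y\in Y$ has some $x\in X$ with $(x,y)\in\mathcal{M}$. Its distortion is $dis_{(X,f),(Y,g)}(\mathcal{M})=\sup_{(x_1,y_1),(x_2,y_2)\in\mathcal{M}}|f(x_1,x_2)-g(y_1,y_2)|$. The correspondence distortion distance is $d_{CD}((X,f),(Y,g))=\frac12\inf_{\mathcal{M}}dis_{(X,f),(Y,g)}(\mathcal{M})\in[0,\infty]$, the infimum over all correspondences between $X$ and $Y$. The associated filtration of directed graphs of $(X,f)$ is $\{D(X,f)_t\}_{t\in\mathbb{R}}$, where $D(X,f)_t$ has vertex set $X_t=\{x\in X: f(x,x)\le t\}$ and a directed edge $x\to y$ whenever $\max\{f(x,x),f(y,y),f(x,y)\}\le t$. A path from $x$ to $y$ in a directed graph is a finite sequence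 of vertices $x=x_0,x_1,\dots,x_n=y$ with each $x_i\to x_{i+1}$ a directed edge (the one-vertex sequence being a path from $x$ to $x$). The associated filtration of preorders is $\{(X_t,\le_t)\}_{t\in\mathbb{R}}$, where $x\le_t y$ iff there is a path from $x$ to $y$ in $D(X,f)_t$. (A preorder is a set with a reflexive, transitive relation.) An ordered tuple is a finite sequence $(v_0,\dots,v_p)$, $p\ge0$, possibly with repeats. An ordered tuple complex (OT-complex) $K$ is a collection of ordered tuples such that if $(v_0,\dots,v_p)\in K$ (with $p\ge1$) then $(v_0,\dots,\hat{v_i},\dots,v_p)\in K$ for all $i$ ($v_i$ removed). Its chain complex has $C_p(K)$ the $\mathbb{F}$-vector space with basis the ordered tuples in $K$ of length $p+1$, boundary $\partial_p(v_0,\dots,v_p)=\sum_{i=0}^p(-1)^i(v_0,\dots,\hat{v_i},\dots,v_p)$ for $p\ge1$ and $\partial_0=0$, and homology $H_k(K)=\ker\partial_k/\operatorname{im}\partial_{k+1}$. A filtration of OT-complexes is a family $\{K_t\}_{t\in\mathbb{R}}$ with $K_t\subset K_r$ for $t\le r$; its $k$-th dimensional ordered tuple persistence module is $\{H_k(K_t)\}_{t\in\mathbb{R}}$ with the maps induced by inclusions. For a preorder $(X,\le)$, the preorder OT-complex $\mathcal{O}(X,\le)$ consists of all ordered tuples $(x_0,\dots,x_p)$ with $x_0\le x_1\le\dots\le x_p$. The preorder filtration (also called preorder Rips filtration) of $(X,f)$ is $\mathcal{O}(X,f)=\{\mathcal{O}(X,f)_t\}_{t\in\mathbb{R}}$ with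 $\mathcal{O}(X,f)_t=\mathcal{O}(X_t,\le_t)$. A persistence module is a family $\{P_t\}_{t\in\mathbb{R}}$ of $\mathbb{F}$-vector spaces with linear maps $\iota_t^s:P_t\to P_s$ for $t\le s$ such that $\iota_t^t=\mathrm{id}$ and $\iota_t^r=\iota_s^r\circ\iota_t^s$ for $t\le s\le r$. Persistence modules $P^X,P^Y$ are $\epsilon$-interleaved if there are families of linear maps $\alpha_t:P^X_t\to P^Y_{t+\epsilon}$ and $\beta_t:P^Y_t\to P^X_{t+\epsilon}$ ($t\in\mathbb{R}$) that commute with the structure maps ($\alpha_{t'}\circ\iota_t^{t'}=\iota_{t+\epsilon}^{t'+\epsilon}\circ\alpha_t$ and $\beta_{t'}\circ\iota_t^{t'}=\iota_{t+\epsilon}^{t'+\epsilon}\circ\beta_t$ for $t\le t'$) and satisfy $\beta_{t+\epsilon}\circ\alpha_t=\iota_t^{t+2\epsilon}$ and $\alpha_{t+\epsilon}\circ\beta_t=\iota_t^{t+2\epsilon}$ for all $t$. The interleaving distance $d_{int}(P^X,P^Y)\in[0,\infty]$ is the infimum of all $\epsilon>0$ such that $P^X,P^Y$ are $\epsilon$-interleaved (infimum of the empty set being $\infty$). *)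

theory Defs
  imports
    "HOL-Library.Extended_Nonnegative_Real"
    "HOL-Library.Poly_Mapping"
    "HOL-Algebra.AbelCoset"
    "Graph_Theory.Pair_Digraph"
    "Graph_Theory.Vertex_Walk"
    "Jordan_Normal_Form.VS_Connect"
begin

hide_const (open) Multiset.mult Polynomial.smult

section \<open>The correspondence distortion distance\<close>

text \<open>
  A set-function pair is given by a set \<open>X\<close> (possibly empty) and a function
  \<open>f\<close>; only the values of \<open>f\<close> on \<open>X \<times> X\<close> matter.
\<close>

definition correspondence :: "'x set \<Rightarrow> 'y set \<Rightarrow> ('x \<times> 'y) set \<Rightarrow> bool" where
  "correspondence X Y M \<longleftrightarrow>
     M \<subseteq> X \<times> Y \<and> (\<forall>x\<in>X. \<exists>y\<in>Y. (x, y) \<in> M) \<and> (\<forall>y\<in>Y. \<exists>x\<in>X. (x, y) \<in> M)"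

definition distortion ::
  "('x \<Rightarrow> 'x \<Rightarrow> real) \<Rightarrow> ('y \<Rightarrow> 'y \<Rightarrow> real) \<Rightarrow> ('x \<times> 'y) set \<Rightarrow> ennreal" where
  "distortion f g M =
     (SUP ((x1, y1), (x2, y2)) \<in> M \<times> M. ennreal \<bar>f x1 x2 - g y1 y2\<bar>)"

definition d_CD ::
  "'x set \<Rightarrow> ('x \<Rightarrow> 'x \<Rightarrow> real) \<Rightarrow> 'y set \<Rightarrow> ('y \<Rightarrow> 'y \<Rightarrow> real) \<Rightarrow> ennreal" where
  "d_CD X f Y g = 1 / 2 * (INF M \<in> {M. correspondence X Y M}. distortion f g M)"


section \<open>The associated filtrations of digraphs and of preorders\<close>

definition sublevel :: "'x set \<Rightarrow> ('x \<Rightarrow> 'x \<Rightarrow> real) \<Rightarrow> real \<Rightarrow> 'x set" where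
  "sublevel X f t = {x \<in> X. f x x \<le> t}"

definition digraph_filtration ::
  "'x set \<Rightarrow> ('x \<Rightarrow> 'x \<Rightarrow> real) \<Rightarrow> real \<Rightarrow> 'x pair_pre_digraph" where
  "digraph_filtration X f t =
     \<lparr> pverts = sublevel X f t,
       parcs = {(x, y). x \<in> X \<and> y \<in> X \<and> max (f x x) (max (f y y) (f x y)) \<le> t} \<rparr>"

definition path_rel :: "'x pair_pre_digraph \<Rightarrow> 'x rel" where
  "path_rel D = {(x, y). \<exists>p. vwalk p (with_proj D) \<and> hd p = x \<and> last p = y}"

lemma path_rel_iff: "(x,y) \<in> path_rel D \<longleftrightarrow> (\<exists>p. set p \<subseteq> pverts D \<and> set (vwalk_arcs p) \<subseteq> parcs D \<and> p \<noteq> [] \<and> hd p = x \<and> last p = y)"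
  by (auto simp: path_rel_def vwalk_def)

lemma vwalk_arcs_append: "p \<noteq> [] \<Longrightarrow> q \<noteq> [] \<Longrightarrow> last p = hd q \<Longrightarrow> set (vwalk_arcs (p @ tl q)) = set (vwalk_arcs p) \<union> set (vwalk_arcs q)"
  by (induction p rule: vwalk_arcs.induct) auto

lemma preorder_on_path_rel: "preorder_on (pverts D) (path_rel D)"
  unfolding preorder_on_def
proof (intro conjI)
  show "path_rel D \<subseteq> pverts D \<times> pverts D" by (auto simp: path_rel_iff subset_eq)
  show "refl_on (pverts D) (path_rel D)"
    by (rule refl_onI) (auto simp: path_rel_iff intro!: exI[of _ "[_]"])
  show "trans (path_rel D)"
  proof (rule transI)
    fix x y z assume "(x,y) \<in> path_rel D" "(y,z) \<in> path_rel D"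
    then obtain p q where "set p \<subseteq> pverts D \<and> set (vwalk_arcs p) \<subseteq> parcs D \<and> p \<noteq> [] \<and> hd p = x \<and> last p = y"
     "set q \<subseteq> pverts D \<and> set (vwalk_arcs q) \<subseteq> parcs D \<and> q \<noteq> [] \<and> hd q = y \<and> last q = z"
      unfolding path_rel_iff by blast
    thus "(x,z) \<in> path_rel D" unfolding path_rel_iff
      by (intro exI[of _ "p @ tl q"]) (auto simp: vwalk_arcs_append dest: list.set_sel(2), (cases q; auto)+)
  qed
qed


section \<open>Ordered tuple complexes\<close>

definition delete_nth :: "nat \<Rightarrow> 'x list \<Rightarrow> 'x list" where
  "delete_nth i v = take i v @ drop (Suc i) v"

definition OT_complex :: "'x list set \<Rightarrow> bool" where
  "OT_complex K \<longleftrightarrow>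
     [] \<notin> K \<and> (\<forall>v\<in>K. 2 \<le> length v \<longrightarrow> (\<forall>i<length v. delete_nth i v \<in> K))"

definition preorder_complex :: "'x set \<Rightarrow> 'x rel \<Rightarrow> 'x list set" where
  "preorder_complex X r =
     {v. v \<noteq> [] \<and> set v \<subseteq> X \<and> successively (\<lambda>x y. (x, y) \<in> r) v}"

definition preorder_filtration ::
  "'x set \<Rightarrow> ('x \<Rightarrow> 'x \<Rightarrow> real) \<Rightarrow> real \<Rightarrow> 'x list set" where
  "preorder_filtration X f t =
     preorder_complex (sublevel X f t) (path_rel (digraph_filtration X f t))"

lemma OT_complex_preorder_complex: assumes "preorder_on X r" shows "OT_complex (preorder_complex X r)"
proof -
  have tr: "trans r" using assms by (simp add: preorder_on_def)
  have t: "transp (\<lambda>x y. (x,y) \<in> r)" using tr by (auto simp: transp_def trans_def)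
  have "sorted_wrt (\<lambda>x y. (x,y) \<in> r) (delete_nth i v)" if "sorted_wrt (\<lambda>x y. (x,y) \<in> r) v" for i v
  proof -
    have "sorted_wrt (\<lambda>x y. (x,y) \<in> r) (take i v @ drop i v)" using that by simp
    hence "sorted_wrt (\<lambda>x y. (x,y) \<in> r) (take i v @ tl (drop i v))"
      unfolding sorted_wrt_append by (cases "drop i v") auto
    thus ?thesis by (simp add: delete_nth_def drop_Suc drop_tl)
  qed
  thus ?thesis
    by (auto simp: OT_complex_def preorder_complex_def successively_conv_sorted_wrt[OF t] delete_nth_def dest!: in_set_takeD in_set_dropD)
qed

lemma OT_complex_preorder_filtration: "OT_complex (preorder_filtration X f t)"
  unfolding preorder_filtration_def
  using OT_complex_preorder_complex preorder_on_path_rel[of "digraph_filtration X f t"]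
  by (simp add: digraph_filtration_def)

lemma mono_preorder_filtration: "mono (preorder_filtration X f)"
proof (rule monoI)
  fix t s :: real assume "t \<le> s"
  hence s: "sublevel X f t \<subseteq> sublevel X f s" "path_rel (digraph_filtration X f t) \<subseteq> path_rel (digraph_filtration X f s)"
    by (fastforce simp: sublevel_def path_rel_iff digraph_filtration_def)+
  show "preorder_filtration X f t \<subseteq> preorder_filtration X f s"
    using s by (auto simp: preorder_filtration_def preorder_complex_def elim!: successively_mono)
qed


section \<open>Homology of ordered tuple complexes\<close>

text \<open>
  Vector spaces over the field \<open>'f\<close> are records \<open>V\<close> with
  \<open>vectorspace (class_ring :: 'f ring) V\<close>. The multiplicative fields of such
  records are irrelevant and left \<open>undefined\<close>.
\<close>

definition chain_space ::
  "'x list set \<Rightarrow> nat \<Rightarrow> ('f::field, 'x list \<Rightarrow>\<^sub>0 'f) module" where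
  "chain_space K p =
     \<lparr> carrier = {c. Poly_Mapping.keys c \<subseteq> {v \<in> K. length v = Suc p}},
       mult = undefined, one = undefined, zero = 0, add = (+),
       smult = (\<lambda>a. Poly_Mapping.map ((*) a)) \<rparr>"

definition OT_boundary :: "nat \<Rightarrow> ('x list \<Rightarrow>\<^sub>0 'f::field) \<Rightarrow> ('x list \<Rightarrow>\<^sub>0 'f)" where
  "OT_boundary p c =
     (if p = 0 then 0
      else \<Sum>v\<in>Poly_Mapping.keys c. \<Sum>i\<le>p.
             Poly_Mapping.single (delete_nth i v) ((-1) ^ i * Poly_Mapping.lookup c v))"

definition cycle_space ::
  "'x list set \<Rightarrow> nat \<Rightarrow> ('f::field, 'x list \<Rightarrow>\<^sub>0 'f) module" where
  "cycle_space K k =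
     (chain_space K k)\<lparr>carrier := {c \<in> carrier (chain_space K k). OT_boundary k c = 0}\<rparr>"

definition boundaries :: "'x list set \<Rightarrow> nat \<Rightarrow> ('x list \<Rightarrow>\<^sub>0 'f::field) set" where
  "boundaries K k = OT_boundary (Suc k) ` carrier (chain_space K (Suc k))"

text \<open>
  The quotient of a vector space by a subspace; its vectors are the cosets. In the
  scalar multiplication, \<open>a\<close> times the set \<open>A\<close> need not be a coset when
  \<open>a\<close> is zero, hence the union of the cosets of its elements.
\<close>

definition quotient_space :: "('f, 'v) module \<Rightarrow> 'v set \<Rightarrow> ('f, 'v set) module" where
  "quotient_space V W =
     \<lparr> carrier = a_rcosets\<^bsub>V\<^esub> W,
       mult = undefined, one = undefined, zero = W, add = set_add V,
       smult = (\<lambda>a A. \<Union>x\<in>A. W +>\<^bsub>V\<^esub> (a \<odot>\<^bsub>V\<^esub> x)) \<rparr>"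

definition homology ::
  "'x list set \<Rightarrow> nat \<Rightarrow> ('f::field, ('x list \<Rightarrow>\<^sub>0 'f) set) module" where
  "homology K k = quotient_space (cycle_space K k) (boundaries K k)"

text \<open>
  The map \<open>[c] \<mapsto> [c]\<close> into the homology of a larger complex \<open>L\<close>; it does not
  mention the smaller complex.
\<close>

definition homology_inclusion ::
  "'x list set \<Rightarrow> nat \<Rightarrow> ('x list \<Rightarrow>\<^sub>0 'f::field) set \<Rightarrow> ('x list \<Rightarrow>\<^sub>0 'f) set" where
  "homology_inclusion L k A = (\<Union>c\<in>A. boundaries L k +>\<^bsub>cycle_space L k\<^esub> c)"


section \<open>Persistence modules and the interleaving distance\<close>

record ('f, 'v) persistence =
  pers_space :: "real \<Rightarrow> ('f, 'v) module"
  pers_map :: "real \<Rightarrow> real \<Rightarrow> 'v \<Rightarrow> 'v"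

definition persistence_module :: "('f::field, 'v) persistence \<Rightarrow> bool" where
  "persistence_module P \<longleftrightarrow>
     (\<forall>t. vectorspace class_ring (pers_space P t)) \<and>
     (\<forall>t s. t \<le> s \<longrightarrow> linear_map class_ring (pers_space P t) (pers_space P s) (pers_map P t s)) \<and>
     (\<forall>t. \<forall>v \<in> carrier (pers_space P t). pers_map P t t v = v) \<and>
     (\<forall>t s r. t \<le> s \<longrightarrow> s \<le> r \<longrightarrow>
        (\<forall>v \<in> carrier (pers_space P t). pers_map P t r v = pers_map P s r (pers_map P t s v)))"

definition interleaved ::
  "real \<Rightarrow> ('f::field, 'v) persistence \<Rightarrow> ('f, 'w) persistence \<Rightarrow> bool" where
  "interleaved \<epsilon> P Q \<longleftrightarrow>
     persistence_module P \<and> persistence_module Q \<and>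
     (\<exists>\<alpha> \<beta>.
        (\<forall>t. linear_map class_ring (pers_space P t) (pers_space Q (t + \<epsilon>)) (\<alpha> t)) \<and>
        (\<forall>t. linear_map class_ring (pers_space Q t) (pers_space P (t + \<epsilon>)) (\<beta> t)) \<and>
        (\<forall>t t'. t \<le> t' \<longrightarrow> (\<forall>v \<in> carrier (pers_space P t).
           \<alpha> t' (pers_map P t t' v) = pers_map Q (t + \<epsilon>) (t' + \<epsilon>) (\<alpha> t v))) \<and>
        (\<forall>t t'. t \<le> t' \<longrightarrow> (\<forall>w \<in> carrier (pers_space Q t).
           \<beta> t' (pers_map Q t t' w) = pers_map P (t + \<epsilon>) (t' + \<epsilon>) (\<beta> t w))) \<and>
        (\<forall>t. \<forall>v \<in> carrier (pers_space P t).
           \<beta> (t + \<epsilon>) (\<alpha> t v) = pers_map P t (t + 2 * \<epsilon>) v) \<and>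
        (\<forall>t. \<forall>w \<in> carrier (pers_space Q t).
           \<alpha> (t + \<epsilon>) (\<beta> t w) = pers_map Q t (t + 2 * \<epsilon>) w))"

text \<open>
  \<open>\<beta> (t + \<epsilon>)\<close> lands in \<open>pers_space P (t + \<epsilon> + \<epsilon>)\<close>, which is \<open>pers_space P (t + 2 * \<epsilon>)\<close>.
\<close>

definition d_int :: "('f::field, 'v) persistence \<Rightarrow> ('f, 'w) persistence \<Rightarrow> ennreal" where
  "d_int P Q = Inf {ennreal \<epsilon> | \<epsilon>. 0 < \<epsilon> \<and> interleaved \<epsilon> P Q}"

definition OT_persistence_module ::
  "(real \<Rightarrow> 'x list set) \<Rightarrow> nat \<Rightarrow> ('f::field, ('x list \<Rightarrow>\<^sub>0 'f) set) persistence" where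
  "OT_persistence_module K k =
     \<lparr> pers_space = (\<lambda>t. homology (K t) k), pers_map = (\<lambda>t s. homology_inclusion (K s) k) \<rparr>"

end

theory Submission
  imports Defs
begin

text \<open>
  Given a correspondence of distortion at most \<open>\<epsilon>\<close>, choose maps \<open>\<phi> : X \<rightarrow> Y\<close> and \<open>\<psi> : Y \<rightarrow> X\<close>
  whose graphs lie in it. They carry chains \<open>x\<^sub>0 \<le>\<^sub>t \<dots> \<le>\<^sub>t x\<^sub>p\<close> to chains at level \<open>t + \<epsilon>\<close>, so they
  induce linear maps on homology. For \<open>h = \<psi> \<circ> \<phi>\<close>, both \<open>x\<close> and \<open>h x\<close> correspond to \<open>\<phi> x\<close>,
  hence \<open>f x (h x) \<le> f x x + 2\<epsilon>\<close> and \<open>x \<le> h x\<close> at level \<open>t + 2\<epsilon>\<close>. Therefore the prism operator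
  \<open>(x\<^sub>0, \<dots>, x\<^sub>p) \<mapsto> \<Sum>i. (-1)^i (x\<^sub>0, \<dots>, x\<^sub>i, h x\<^sub>i, \<dots>, h x\<^sub>p)\<close> takes values in the complex at
  level \<open>t + 2\<epsilon>\<close>, and it is a chain homotopy from the inclusion to \<open>h\<close>. The same holds for
  \<open>\<phi> \<circ> \<psi>\<close>, so the two persistence modules are \<open>\<epsilon>\<close>-interleaved.
\<close>

section \<open>Linear maps on free vector spaces\<close>

abbreviation scale :: "'f::field \<Rightarrow> ('a \<Rightarrow>\<^sub>0 'f) \<Rightarrow> ('a \<Rightarrow>\<^sub>0 'f)" where
  "scale a \<equiv> Poly_Mapping.map ((*) a)"

lemma lookup_scale [simp]:
  "Poly_Mapping.lookup (scale a c) v = a * Poly_Mapping.lookup c v"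
  by (simp add: Poly_Mapping.map.rep_eq when_def)

lemma keys_scale: "Poly_Mapping.keys (scale a c) \<subseteq> Poly_Mapping.keys c"
  by (auto simp: in_keys_iff)

lemma vector_space_scale: "vector_space scale"
  by (auto simp: vector_space_def lookup_add algebra_simps intro!: poly_mapping_eqI)

interpretation fv: vector_space scale
  by (rule vector_space_scale)

interpretation fv: vector_space_pair scale scale
  by unfold_locales

abbreviation lin_map :: "(('a \<Rightarrow>\<^sub>0 'f::field) \<Rightarrow> ('b \<Rightarrow>\<^sub>0 'f)) \<Rightarrow> bool" where
  "lin_map \<equiv> Vector_Spaces.linear scale scale"

abbreviation basis_vec :: "'a \<Rightarrow> ('a \<Rightarrow>\<^sub>0 'f::field)" where
  "basis_vec v \<equiv> Poly_Mapping.single v 1"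

lemma sum_basis_vec:
  "(\<Sum>v\<in>Poly_Mapping.keys c. scale (Poly_Mapping.lookup c v) (basis_vec v)) = c"
proof (rule poly_mapping_eqI)
  fix w
  have "Poly_Mapping.lookup (\<Sum>v\<in>Poly_Mapping.keys c. scale (Poly_Mapping.lookup c v) (basis_vec v)) w
      = (\<Sum>v\<in>Poly_Mapping.keys c. if v = w then Poly_Mapping.lookup c v else 0)"
    by (auto simp: lookup_sum lookup_single when_def intro!: sum.cong)
  then show "Poly_Mapping.lookup (\<Sum>v\<in>Poly_Mapping.keys c. scale (Poly_Mapping.lookup c v) (basis_vec v)) w
      = Poly_Mapping.lookup c w"
    by (simp add: in_keys_iff)
qed

lemma lin_map_conv_sum:
  assumes "lin_map F"
  shows "F c = (\<Sum>v\<in>Poly_Mapping.keys c. scale (Poly_Mapping.lookup c v) (F (basis_vec v)))"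
proof -
  have "F c = F (\<Sum>v\<in>Poly_Mapping.keys c. scale (Poly_Mapping.lookup c v) (basis_vec v))"
    by (simp only: sum_basis_vec)
  then show ?thesis
    by (simp only: fv.linear_sum[OF assms] fv.linear_scale[OF assms])
qed

text \<open>Agreement is required only on the basis vectors that occur in \<open>c\<close>. The
  degree-0 case of \<open>prism_boundary_cycle\<close> relies on this: its identity is checked only
  on tuples of length one.\<close>

lemma lin_map_eq:
  assumes "lin_map F" "lin_map G"
    and "\<And>v. v \<in> Poly_Mapping.keys c \<Longrightarrow> F (basis_vec v) = G (basis_vec v)"
  shows "F c = G c"
  using assms by (simp add: lin_map_conv_sum[of F c] lin_map_conv_sum[of G c])

lemma keys_sum_subset:
  "Poly_Mapping.keys (\<Sum>i\<in>S. F i) \<subseteq> (\<Union>i\<in>S. Poly_Mapping.keys (F i))"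
proof (induction S rule: infinite_finite_induct)
  case (insert i S)
  then show ?case using keys_add[of "F i" "sum F S"] by auto
qed auto

lemma keys_lin_map:
  assumes "lin_map F"
  shows "Poly_Mapping.keys (F c) \<subseteq> (\<Union>v\<in>Poly_Mapping.keys c. Poly_Mapping.keys (F (basis_vec v)))"
proof -
  have "Poly_Mapping.keys (F c) \<subseteq> (\<Union>v\<in>Poly_Mapping.keys c.
      Poly_Mapping.keys (scale (Poly_Mapping.lookup c v) (F (basis_vec v))))"
    by (subst lin_map_conv_sum[OF assms]) (rule keys_sum_subset)
  also have "\<dots> \<subseteq> (\<Union>v\<in>Poly_Mapping.keys c. Poly_Mapping.keys (F (basis_vec v)))"
    by (intro UN_mono subset_refl keys_scale)
  finally show ?thesis .
qed

definition lin_ext :: "('a \<Rightarrow> ('b \<Rightarrow>\<^sub>0 'f::field)) \<Rightarrow> ('a \<Rightarrow>\<^sub>0 'f) \<Rightarrow> ('b \<Rightarrow>\<^sub>0 'f)" where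
  "lin_ext F c = (\<Sum>v\<in>Poly_Mapping.keys c. scale (Poly_Mapping.lookup c v) (F v))"

text \<open>The index set \<open>keys c\<close> changes under addition because coefficients may
  cancel. Summing over a common finite superset makes the sums for \<open>c\<close>,
  \<open>d\<close> and \<open>c + d\<close> comparable term by term.\<close>

lemma lin_ext_superset:
  assumes "finite S" "Poly_Mapping.keys c \<subseteq> S"
  shows "lin_ext F c = (\<Sum>v\<in>S. scale (Poly_Mapping.lookup c v) (F v))"
  unfolding lin_ext_def using assms
  by (intro sum.mono_neutral_left) (auto simp: in_keys_iff)

lemma lin_map_lin_ext:
  fixes F :: "'a \<Rightarrow> ('b \<Rightarrow>\<^sub>0 'f::field)"
  shows "lin_map (lin_ext F)"
proof (unfold Vector_Spaces.linear_iff, intro conjI allI vector_space_scale)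
  fix c d :: "'a \<Rightarrow>\<^sub>0 'f" and a :: 'f
  let ?S = "Poly_Mapping.keys c \<union> Poly_Mapping.keys d"
  have "Poly_Mapping.keys (c + d) \<subseteq> ?S" by (rule keys_add)
  then show "lin_ext F (c + d) = lin_ext F c + lin_ext F d"
    by (simp add: lin_ext_superset[of ?S] lookup_add fv.scale_left_distrib sum.distrib)
  show "lin_ext F (scale a c) = scale a (lin_ext F c)"
    using keys_scale[of a c]
    by (simp add: lin_ext_superset[of "Poly_Mapping.keys c"] fv.scale_sum_right)
qed

lemma lin_ext_basis_vec [simp]: "lin_ext F (basis_vec v) = F v"
  by (simp add: lin_ext_def)

lemma lin_map_comp: "lin_map F \<Longrightarrow> lin_map G \<Longrightarrow> lin_map (\<lambda>c. F (G c))"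
  by (simp add: Vector_Spaces.linear_iff)

lemma lin_map_id [simp]: "lin_map (\<lambda>c. c)"
  by (simp add: Vector_Spaces.linear_iff vector_space_scale)

lemmas [simp] = fv.linear_zero fv.linear_compose_add fv.linear_compose_sub


section \<open>The boundary, simplicial maps and the prism operator\<close>

text \<open>The algebraic cone with apex \<open>a\<close>. Boundary, vertex maps and prism all
  satisfy a recursion through this operator, so identities between them can be proved by induction
  on the tuple.\<close>

definition cons_chain :: "'x \<Rightarrow> ('x list \<Rightarrow>\<^sub>0 'f::field) \<Rightarrow> ('x list \<Rightarrow>\<^sub>0 'f)" where
  "cons_chain a = lin_ext (\<lambda>v. basis_vec (a # v))"

definition tuple_boundary :: "'x list \<Rightarrow> ('x list \<Rightarrow>\<^sub>0 'f::field)" where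
  "tuple_boundary v = (\<Sum>i<length v. scale ((-1) ^ i) (basis_vec (delete_nth i v)))"

text \<open>
  The augmented boundary: a one-vertex tuple is mapped to the empty tuple. This makes the
  recursion \<open>\<partial>(a # v) = v - a # \<partial>v\<close> valid for all tuples.
\<close>

definition boundary :: "('x list \<Rightarrow>\<^sub>0 'f::field) \<Rightarrow> ('x list \<Rightarrow>\<^sub>0 'f)" where
  "boundary = lin_ext tuple_boundary"

definition chain_map :: "('x \<Rightarrow> 'y) \<Rightarrow> ('x list \<Rightarrow>\<^sub>0 'f::field) \<Rightarrow> ('y list \<Rightarrow>\<^sub>0 'f)" where
  "chain_map \<phi> = lin_ext (\<lambda>v. basis_vec (map \<phi> v))"

text \<open>The alternating prism sum in recursive form: the summand with i = 0 comes first, and all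
  the others start with \<open>a\<close> and carry the opposite sign, since their index drops by one
  in \<open>v\<close>.\<close>

fun tuple_prism :: "('x \<Rightarrow> 'x) \<Rightarrow> 'x list \<Rightarrow> ('x list \<Rightarrow>\<^sub>0 'f::field)" where
  "tuple_prism h [] = 0"
| "tuple_prism h (a # v) = basis_vec (a # h a # map h v) - cons_chain a (tuple_prism h v)"

definition prism :: "('x \<Rightarrow> 'x) \<Rightarrow> ('x list \<Rightarrow>\<^sub>0 'f::field) \<Rightarrow> ('x list \<Rightarrow>\<^sub>0 'f)" where
  "prism h = lin_ext (tuple_prism h)"

lemmas chain_op_defs = cons_chain_def boundary_def chain_map_def prism_def

lemma lin_map_chain_ops [simp]:
  "lin_map (cons_chain a)" "lin_map boundary" "lin_map (chain_map \<phi>)" "lin_map (prism h)"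
  by (simp_all add: chain_op_defs lin_map_lin_ext)

lemmas lin_map_chain_ops_comp [simp] = lin_map_chain_ops[THEN lin_map_comp]

lemma chain_ops_basis_vec [simp]:
  "cons_chain a (basis_vec v) = basis_vec (a # v)"
  "boundary (basis_vec v) = tuple_boundary v"
  "chain_map \<phi> (basis_vec v) = basis_vec (map \<phi> v)"
  "prism h (basis_vec v) = tuple_prism h v"
  by (simp_all add: chain_op_defs)

lemmas chain_ops_linear =
  lin_map_chain_ops[THEN fv.linear_add] lin_map_chain_ops[THEN fv.linear_diff]
  lin_map_chain_ops[THEN fv.linear_scale] lin_map_chain_ops[THEN fv.linear_0]
  lin_map_chain_ops[THEN fv.linear_sum]

lemma tuple_boundary_Nil [simp]: "tuple_boundary [] = 0"
  by (simp add: tuple_boundary_def)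

text \<open>Split the alternating sum at index 0: that face is \<open>v\<close>, while a face of
  index \<open>Suc i\<close> keeps \<open>a\<close> and has the sign of face \<open>i\<close> of
  \<open>v\<close> reversed.\<close>

lemma tuple_boundary_Cons [simp]:
  "tuple_boundary (a # v) = basis_vec v - cons_chain a (tuple_boundary v)"
proof -
  have [simp]: "delete_nth 0 (a # v) = v" "delete_nth (Suc i) (a # v) = a # delete_nth i v" for i
    by (simp_all add: delete_nth_def)
  have "cons_chain a (tuple_boundary v :: 'a list \<Rightarrow>\<^sub>0 'b)
      = (\<Sum>i<length v. scale ((-1) ^ i) (basis_vec (a # delete_nth i v)))"
    by (simp add: tuple_boundary_def chain_ops_linear del: Poly_Mapping.map_single)
  then show ?thesis
    by (simp add: tuple_boundary_def sum.lessThan_Suc_shift fv.scale_minus_left sum_negf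
        del: Poly_Mapping.map_single sum.lessThan_Suc)
qed

lemma boundary_cons_chain: "boundary (cons_chain a c) = c - cons_chain a (boundary c)"
  by (rule lin_map_eq[where c = c])
    simp_all

lemma chain_map_cons_chain: "chain_map \<phi> (cons_chain a c) = cons_chain (\<phi> a) (chain_map \<phi> c)"
  by (rule lin_map_eq[where c = c])
    simp_all

lemma prism_cons_chain:
  "prism h (cons_chain a c) = cons_chain a (cons_chain (h a) (chain_map h c)) - cons_chain a (prism h c)"
  by (rule lin_map_eq[where c = c])
    simp_all

lemma chain_map_tuple_boundary: "chain_map \<phi> (tuple_boundary v) = tuple_boundary (map \<phi> v)"
  by (induction v) (simp_all add: chain_ops_linear chain_map_cons_chain)

lemma boundary_chain_map: "boundary (chain_map \<phi> c) = chain_map \<phi> (boundary c)"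
  by (rule lin_map_eq[where c = c])
    (simp_all add: chain_map_tuple_boundary)

lemma chain_map_chain_map: "chain_map \<psi> (chain_map \<phi> c) = chain_map (\<psi> \<circ> \<phi>) c"
  by (rule lin_map_eq[where c = c]) (simp_all add: comp_def)

lemma chain_map_id: "chain_map id c = c"
  by (rule lin_map_eq[where c = c]) simp_all

text \<open>Expanding both summands for \<open>a # v\<close>, the two copies of
  \<open>tuple_prism h v\<close> cancel, and so do the terms starting with \<open>a\<close> and
  \<open>h a\<close>, because \<open>h\<close> commutes with the boundary. What remains is the tuple
  of images minus \<open>a # map h v\<close>, plus the induction hypothesis with \<open>a\<close>
  prepended.\<close>

lemma prism_homotopy_tuple:
  "boundary (tuple_prism h v) + prism h (tuple_boundary v)
    = (basis_vec (map h v) - basis_vec v :: 'x list \<Rightarrow>\<^sub>0 'f::field)"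
proof (induction v)
  case (Cons a v)
  have "cons_chain a (boundary (tuple_prism h v)) + cons_chain a (prism h (tuple_boundary v))
      = (basis_vec (a # map h v) - basis_vec (a # v) :: 'x list \<Rightarrow>\<^sub>0 'f)"
    using arg_cong[OF Cons.IH, of "cons_chain a"] by (simp add: chain_ops_linear)
  then show ?case
    by (simp add: chain_ops_linear boundary_cons_chain prism_cons_chain chain_map_tuple_boundary
        algebra_simps)
qed (simp add: chain_ops_linear)

lemma prism_homotopy: "boundary (prism h c) + prism h (boundary c) = chain_map h c - c"
  by (rule lin_map_eq[where c = c])
    (simp_all add: prism_homotopy_tuple)


section \<open>Homology classes\<close>

abbreviation lin_subspace :: "('a \<Rightarrow>\<^sub>0 'f::field) set \<Rightarrow> bool" where
  "lin_subspace \<equiv> Modules.module.subspace scale"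

section \<open>Cosets of a subspace\<close>

abbreviation coset :: "('a \<Rightarrow>\<^sub>0 'f::field) set \<Rightarrow> ('a \<Rightarrow>\<^sub>0 'f) \<Rightarrow> ('a \<Rightarrow>\<^sub>0 'f) set" where
  "coset W c \<equiv> (\<lambda>b. b + c) ` W"

lemma mem_coset_iff: "x \<in> coset W c \<longleftrightarrow> x - c \<in> W"
  by (force intro: image_eqI[of _ _ "x - c"])

lemma coset_eqI:
  assumes "lin_subspace W" "c - d \<in> W"
  shows "coset W c = coset W d"
proof -
  have "x - c \<in> W \<longleftrightarrow> x - d \<in> W" for x
    using fv.subspace_add[OF assms(1) _ assms(2), of "x - c"]
      fv.subspace_diff[OF assms(1) _ assms(2), of "x - d"] by auto
  then show ?thesis by (simp add: set_eq_iff mem_coset_iff)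
qed

text \<open>Since \<open>F\<close> maps \<open>W\<close> into \<open>W'\<close>, all representatives
  of a coset have images in one coset, so the union collapses; \<open>0 \<in> W\<close> ensures that
  it is not empty. Both the scalar multiplication of the quotient and the induced maps are unions of
  this kind.\<close>

lemma UN_coset:
  assumes "lin_map F" "lin_subspace W'" "F ` W \<subseteq> W'" "0 \<in> W"
  shows "(\<Union>x\<in>coset W c. coset W' (F x)) = coset W' (F c)"
proof -
  have "coset W' (F (b + c)) = coset W' (F c)" if "b \<in> W" for b
    using that assms by (intro coset_eqI) (auto simp: fv.linear_add)
  then show ?thesis using assms(4) by (simp add: image_image) blast
qed

lemma Un_coset_add:
  assumes "lin_subspace W"
  shows "(\<Union>x\<in>coset W c. \<Union>y\<in>coset W d. {x + y}) = coset W (c + d)"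
proof (intro equalityI subsetI)
  fix z assume "z \<in> (\<Union>x\<in>coset W c. \<Union>y\<in>coset W d. {x + y})"
  then obtain a b where "a \<in> W" "b \<in> W" "z = (a + c) + (b + d)" by auto
  then show "z \<in> coset W (c + d)"
    using fv.subspace_add[OF assms, of a b] by (auto simp: mem_coset_iff algebra_simps)
next
  fix z assume "z \<in> coset W (c + d)"
  then obtain a where "a \<in> W" "z = (a + c) + (0 + d)" by (auto simp: algebra_simps)
  then show "z \<in> (\<Union>x\<in>coset W c. \<Union>y\<in>coset W d. {x + y})"
    using fv.subspace_0[OF assms] by blast
qed

section \<open>Chains, cycles and boundaries as subspaces\<close>

abbreviation chains :: "'x list set \<Rightarrow> nat \<Rightarrow> ('x list \<Rightarrow>\<^sub>0 'f::field) set" where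
  "chains K k \<equiv> carrier (chain_space K k)"

abbreviation cycles :: "'x list set \<Rightarrow> nat \<Rightarrow> ('x list \<Rightarrow>\<^sub>0 'f::field) set" where
  "cycles K k \<equiv> carrier (cycle_space K k)"

lemma a_r_coset_cycle_space: "W +>\<^bsub>cycle_space K k\<^esub> c = coset W c"
  by (auto simp: a_r_coset_def r_coset_def cycle_space_def chain_space_def)

lemma mem_chains_iff: "c \<in> chains K k \<longleftrightarrow> (\<forall>v\<in>Poly_Mapping.keys c. v \<in> K \<and> length v = Suc k)"
  by (auto simp: chain_space_def)

lemma lin_subspace_chains: "lin_subspace (chains K k)"
  by (rule fv.subspaceI) (auto simp: mem_chains_iff dest!: subsetD[OF keys_add] subsetD[OF keys_scale])

text \<open>Tuples in degree \<open>Suc k\<close> have length \<open>Suc (Suc k)\<close>, so the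
  ranges \<open>i \<le> Suc k\<close> and \<open>i < length v\<close> coincide. The augmentation
  changes the boundary in degree 0 only.\<close>

lemma OT_boundary_eq_boundary:
  assumes "c \<in> chains K (Suc k)"
  shows "OT_boundary (Suc k) c = boundary c"
proof -
  have "scale (Poly_Mapping.lookup c v) (tuple_boundary v)
      = (\<Sum>i\<le>Suc k. Poly_Mapping.single (delete_nth i v) ((-1) ^ i * Poly_Mapping.lookup c v))"
    if "v \<in> Poly_Mapping.keys c" for v
    using that assms
    by (simp add: mem_chains_iff tuple_boundary_def fv.scale_sum_right lessThan_Suc_atMost mult.commute
        del: sum.atMost_Suc)
  then show ?thesis by (simp add: OT_boundary_def boundary_def lin_ext_def)
qed

lemma boundaries_eq: "boundaries K k = boundary ` chains K (Suc k)"
  by (auto simp: boundaries_def OT_boundary_eq_boundary image_iff)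

text \<open>In degree 0 the boundary is zero by convention, while the augmented one need not vanish.
  Arguments about cycles therefore split on the degree.\<close>

lemma cycles_0: "cycles K 0 = chains K 0"
  by (auto simp: cycle_space_def OT_boundary_def)

lemma cycles_Suc: "cycles K (Suc k) = chains K (Suc k) \<inter> {c. boundary c = 0}"
  by (auto simp: cycle_space_def OT_boundary_eq_boundary)

lemma lin_subspace_boundaries: "lin_subspace (boundaries K k)"
  by (simp add: boundaries_eq fv.linear_subspace_image lin_subspace_chains)

lemma lin_subspace_cycles: "lin_subspace (cycles K k)"
  by (cases k) (simp_all add: cycles_0 cycles_Suc lin_subspace_chains fv.linear_subspace_kernel
      fv.subspace_inter)

lemma cycles_subset_chains: "cycles K k \<subseteq> chains K k"
  by (auto simp: cycle_space_def)

section \<open>Homology as a vector space of classes\<close>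

definition hclass :: "'x list set \<Rightarrow> nat \<Rightarrow> ('x list \<Rightarrow>\<^sub>0 'f::field) \<Rightarrow> ('x list \<Rightarrow>\<^sub>0 'f) set" where
  "hclass K k c = coset (boundaries K k) c"

lemma carrier_homology: "carrier (homology K k) = hclass K k ` cycles K k"
  by (auto simp: homology_def quotient_space_def A_RCOSETS_def RCOSETS_def hclass_def
      a_r_coset_def[symmetric] a_r_coset_cycle_space)

lemma hclass_in_homology: "c \<in> cycles K k \<Longrightarrow> hclass K k c \<in> carrier (homology K k)"
  by (simp add: carrier_homology)

lemma homologyE:
  assumes "A \<in> carrier (homology K k)"
  obtains c where "c \<in> cycles K k" "A = hclass K k c"
  using assms by (auto simp: carrier_homology)

lemma zero_homology: "\<zero>\<^bsub>homology K k\<^esub> = hclass K k 0"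
  by (simp add: homology_def quotient_space_def hclass_def)

lemma add_homology:
  fixes c d :: "'x list \<Rightarrow>\<^sub>0 'f::field"
  shows "hclass K k c \<oplus>\<^bsub>homology K k\<^esub> hclass K k d = hclass K k (c + d)"
proof -
  have "(\<oplus>\<^bsub>homology K k\<^esub>) = (\<lambda>A B :: ('x list \<Rightarrow>\<^sub>0 'f) set. \<Union>x\<in>A. \<Union>y\<in>B. {x + y})"
    by (intro ext) (simp add: homology_def quotient_space_def set_add_def set_mult_def cycle_space_def
        chain_space_def)
  then show ?thesis
    by (simp only: hclass_def Un_coset_add[OF lin_subspace_boundaries])
qed

lemma smult_homology:
  fixes c :: "'x list \<Rightarrow>\<^sub>0 'f::field"
  shows "a \<odot>\<^bsub>homology K k\<^esub> hclass K k c = hclass K k (scale a c)"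
proof -
  have smult: "(\<odot>\<^bsub>homology K k\<^esub>) = (\<lambda>(a :: 'f) (A :: ('x list \<Rightarrow>\<^sub>0 'f) set). \<Union>x\<in>A. coset (boundaries K k) (scale a x))"
    by (intro ext) (simp add: homology_def quotient_space_def a_r_coset_cycle_space,
        simp add: cycle_space_def chain_space_def)
  have "lin_map (scale a)" by (rule fv.linear_scale_self)
  moreover have "scale a ` boundaries K k \<subseteq> (boundaries K k :: ('x list \<Rightarrow>\<^sub>0 'f) set)"
    using fv.subspace_scale[OF lin_subspace_boundaries] by blast
  ultimately show ?thesis
    unfolding smult hclass_def by (intro UN_coset lin_subspace_boundaries fv.subspace_0)
qed

text \<open>By the formulas for zero, sum and scalar multiple of classes, each axiom reduces to the
  same axiom for representing cycles.\<close>

lemma vectorspace_homology: "vectorspace class_ring (homology K k :: ('f::field, ('x list \<Rightarrow>\<^sub>0 'f) set) module)"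
proof -
  let ?H = "homology K k :: ('f, ('x list \<Rightarrow>\<^sub>0 'f) set) module"
  note cl = hclass_in_homology fv.subspace_0[OF lin_subspace_cycles] fv.subspace_add[OF lin_subspace_cycles]
    fv.subspace_scale[OF lin_subspace_cycles] fv.subspace_neg[OF lin_subspace_cycles]
  have "abelian_group ?H"
  proof (rule abelian_groupI)
    fix A assume "A \<in> carrier ?H"
    then obtain c where c: "c \<in> cycles K k" "A = hclass K k c" by (rule homologyE)
    then have "hclass K k (- c) \<oplus>\<^bsub>?H\<^esub> A = \<zero>\<^bsub>?H\<^esub>"
      by (simp add: add_homology zero_homology)
    then show "\<exists>B\<in>carrier ?H. B \<oplus>\<^bsub>?H\<^esub> A = \<zero>\<^bsub>?H\<^esub>"
      by (rule bexI) (intro cl c)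
  qed (auto elim!: homologyE simp: add_homology zero_homology add_ac cl)
  moreover have field: "field (class_ring :: 'f ring)" by (rule class_field)
  moreover have "cring (class_ring :: 'f ring)"
    using field by (simp add: field_def domain_def)
  ultimately have "Module.module class_ring ?H"
    by (intro moduleI)
       (auto elim!: homologyE simp: class_ring_simps add_homology smult_homology cl
          fv.scale_left_distrib fv.scale_right_distrib)
  then show ?thesis
    using field by (simp add: vectorspace_def)
qed

section \<open>Maps induced on homology by vertex maps\<close>

definition homology_map ::
  "'y list set \<Rightarrow> nat \<Rightarrow> ('x \<Rightarrow> 'y) \<Rightarrow> ('x list \<Rightarrow>\<^sub>0 'f::field) set \<Rightarrow> ('y list \<Rightarrow>\<^sub>0 'f) set" where
  "homology_map L k \<phi> A = (\<Union>c\<in>A. hclass L k (chain_map \<phi> c))"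

lemma homology_inclusion_eq_homology_map: "homology_inclusion L k = homology_map L k id"
  by (rule ext) (simp add: homology_inclusion_def homology_map_def hclass_def a_r_coset_cycle_space chain_map_id)

lemma keys_chain_map:
  "Poly_Mapping.keys (chain_map \<phi> c :: 'y list \<Rightarrow>\<^sub>0 'f::field) \<subseteq> map \<phi> ` Poly_Mapping.keys c"
  using keys_lin_map[of "chain_map \<phi>" c] by auto

lemma chain_map_chains:
  assumes "map \<phi> ` K \<subseteq> L" "c \<in> chains K k"
  shows "chain_map \<phi> c \<in> chains L k"
  using assms keys_chain_map[of \<phi> c] by (fastforce simp: mem_chains_iff)

lemma chain_map_cycles:
  assumes "map \<phi> ` K \<subseteq> L" "c \<in> cycles K k"
  shows "chain_map \<phi> c \<in> cycles L k"
  using assms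
  by (cases k) (auto simp: cycles_0 cycles_Suc chain_map_chains boundary_chain_map chain_ops_linear)

lemma chain_map_boundaries:
  assumes "map \<phi> ` K \<subseteq> L"
  shows "chain_map \<phi> ` boundaries K k \<subseteq> boundaries L k"
  by (auto simp: boundaries_eq boundary_chain_map[symmetric] intro!: imageI chain_map_chains[OF assms])

text \<open>Independence of the representative: chain maps send boundaries to boundaries. Since the
  structure maps are the case \<open>\<phi> = id\<close>, they and the interleaving maps obey one
  composition law.\<close>

lemma homology_map_hclass:
  assumes "map \<phi> ` K \<subseteq> L"
  shows "homology_map L k \<phi> (hclass K k c) = hclass L k (chain_map \<phi> c)"
  unfolding homology_map_def hclass_def
  by (intro UN_coset lin_subspace_boundaries chain_map_boundaries[OF assms] lin_map_chain_ops
      fv.subspace_0)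

lemma linear_map_homology_map:
  assumes "map \<phi> ` K \<subseteq> L"
  shows "linear_map class_ring (homology K k :: ('f::field, _) module) (homology L k) (homology_map L k \<phi>)"
proof (intro linear_map.intro mod_hom.intro mod_hom_axioms.intro vectorspace_homology)
  show "Module.module class_ring (homology K k :: ('f, _) module)"
    "Module.module class_ring (homology L k :: ('f, _) module)"
    using vectorspace_homology vectorspace_def by blast+
  show "homology_map L k \<phi> \<in> LinearCombinations.module_hom class_ring
      (homology K k :: ('f, _) module) (homology L k)"
    by (auto simp: LinearCombinations.module_hom_def carrier_homology add_homology smult_homology
      homology_map_hclass[OF assms] chain_ops_linear chain_map_cycles[OF assms])
qed

lemma homology_map_comp:
  assumes "map \<phi> ` K \<subseteq> L" "map \<psi> ` L \<subseteq> M" "A \<in> carrier (homology K k)"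
  shows "homology_map M k \<psi> (homology_map L k \<phi> A) = homology_map M k (\<psi> \<circ> \<phi>) A"
proof -
  obtain c where "A = hclass K k c" using assms(3) by (rule homologyE)
  moreover have "map (\<psi> \<circ> \<phi>) ` K \<subseteq> M" using assms(1,2) by (auto simp flip: map_map)
  ultimately show ?thesis
    by (simp add: homology_map_hclass[OF assms(1)] homology_map_hclass[OF assms(2)]
      homology_map_hclass[of "\<psi> \<circ> \<phi>" K M] chain_map_chain_map)
qed

lemma homology_map_id:
  assumes "A \<in> carrier (homology K k)"
  shows "homology_map K k id A = A"
proof -
  obtain c where "A = hclass K k c" using assms by (rule homologyE)
  then show ?thesis by (simp add: homology_map_hclass[of id K K] chain_map_id)
qed

text \<open>In positive degree the boundary itself vanishes. In degree 0 the augmented boundary is a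
  multiple of the empty tuple, and the prism of the empty tuple is zero.\<close>

lemma prism_boundary_cycle:
  assumes "c \<in> cycles K k"
  shows "prism h (boundary c) = 0"
proof (cases k)
  case 0
  then have "\<exists>a. v = [a]" if "v \<in> Poly_Mapping.keys c" for v
    using that assms by (auto simp: cycles_0 mem_chains_iff length_Suc_conv)
  then have "prism h (boundary (basis_vec v)) = 0" if "v \<in> Poly_Mapping.keys c" for v
    using that by (fastforce simp: chain_ops_linear)
  then show ?thesis
    by (intro lin_map_eq[where c = c and F = "\<lambda>c. prism h (boundary c)" and G = "\<lambda>_. 0"])
      (simp_all del: chain_ops_basis_vec)
qed (use assms in \<open>auto simp: cycles_Suc chain_ops_linear\<close>)

text \<open>For a cycle \<open>c\<close>, the homotopy formula reduces to
  \<open>boundary (prism h c) = chain_map h c - c\<close>. The hypothesis \<open>prism\<close>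
  places \<open>prism h c\<close> inside \<open>L\<close>, so this difference is a boundary
  there.\<close>

lemma homology_map_eq_id:
  assumes "map h ` K \<subseteq> L" "K \<subseteq> L"
    and prism: "\<And>v. v \<in> K \<Longrightarrow> Poly_Mapping.keys (tuple_prism h v :: 'x list \<Rightarrow>\<^sub>0 'f::field)
                  \<subseteq> {w \<in> L. length w = Suc (length v)}"
    and "A \<in> carrier (homology K k :: ('f, _) module)"
  shows "homology_map L k h A = homology_map L k id A"
proof -
  obtain c where c: "c \<in> cycles K k" "A = hclass K k c" using assms(4) by (rule homologyE)
  have "c \<in> chains K k" using c(1) cycles_subset_chains by blast
  then have "prism h c \<in> chains L (Suc k)"
    using keys_lin_map[of "prism h" c] prism by (fastforce simp: mem_chains_iff)
  then have "boundary (prism h c) \<in> boundaries L k" by (auto simp: boundaries_eq)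
  then have "chain_map h c - c \<in> boundaries L k"
    using prism_homotopy[of h c] prism_boundary_cycle[OF c(1), of h] by simp
  then have "hclass L k (chain_map h c) = hclass L k c"
    unfolding hclass_def by (rule coset_eqI[OF lin_subspace_boundaries])
  then show ?thesis
    using assms(1,2) by (simp add: c homology_map_hclass[of _ K L] chain_map_id)
qed


section \<open>Interleavings\<close>

lemma OT_persistence_module_simps [simp]:
  "pers_space (OT_persistence_module K k) t = homology (K t) k"
  "pers_map (OT_persistence_module K k) t s = homology_map (K s) k id"
  by (simp_all add: OT_persistence_module_def homology_inclusion_eq_homology_map)

lemma persistence_module_OT:
  assumes "mono K"
  shows "persistence_module (OT_persistence_module K k :: ('f::field, ('x list \<Rightarrow>\<^sub>0 'f) set) persistence)"
proof -
  have sub: "map id ` K t \<subseteq> K s" if "t \<le> s" for t s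
    using monoD[OF assms that] by simp
  show ?thesis
    unfolding persistence_module_def
  proof (intro conjI allI impI ballI)
    fix t s r :: real and A :: "('x list \<Rightarrow>\<^sub>0 'f) set"
    assume "t \<le> s" "s \<le> r" "A \<in> carrier (pers_space (OT_persistence_module K k) t)"
    then show "pers_map (OT_persistence_module K k) t r A
        = pers_map (OT_persistence_module K k) s r (pers_map (OT_persistence_module K k) t s A)"
      using homology_map_comp[OF sub[of t s] sub[of s r], of A k] by simp
  qed (simp_all add: vectorspace_homology linear_map_homology_map[OF sub] homology_map_id)
qed

text \<open>Naturality is functoriality alone, as both composites are induced by the same vertex
  map. The round trips are induced by \<open>\<psi> \<circ> \<phi>\<close> and
  \<open>\<phi> \<circ> \<psi>\<close>, and the prism hypotheses identify these with the structure
  maps.\<close>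

lemma interleaved_OT:
  fixes K :: "real \<Rightarrow> 'x list set" and L :: "real \<Rightarrow> 'y list set"
  assumes mono: "mono K" "mono L" and "0 \<le> \<epsilon>"
    and \<phi>: "\<And>t. map \<phi> ` K t \<subseteq> L (t + \<epsilon>)" and \<psi>: "\<And>t. map \<psi> ` L t \<subseteq> K (t + \<epsilon>)"
    and prism_K: "\<And>t v. v \<in> K t \<Longrightarrow> Poly_Mapping.keys (tuple_prism (\<psi> \<circ> \<phi>) v :: 'x list \<Rightarrow>\<^sub>0 'f::field)
                     \<subseteq> {w \<in> K (t + 2 * \<epsilon>). length w = Suc (length v)}"
    and prism_L: "\<And>t v. v \<in> L t \<Longrightarrow> Poly_Mapping.keys (tuple_prism (\<phi> \<circ> \<psi>) v :: 'y list \<Rightarrow>\<^sub>0 'f)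
                     \<subseteq> {w \<in> L (t + 2 * \<epsilon>). length w = Suc (length v)}"
  shows "interleaved \<epsilon> (OT_persistence_module K k :: ('f, ('x list \<Rightarrow>\<^sub>0 'f) set) persistence)
           (OT_persistence_module L k)"
proof -
  have K_sub: "map id ` K t \<subseteq> K s" if "t \<le> s" for t s
    using monoD[OF mono(1) that] by simp
  have L_sub: "map id ` L t \<subseteq> L s" if "t \<le> s" for t s
    using monoD[OF mono(2) that] by simp
  have \<phi>\<psi>: "map (\<phi> \<circ> \<psi>) ` L t \<subseteq> L (t + 2 * \<epsilon>)" for t
    using image_mono[OF \<psi>[of t], of "map \<phi>"] \<phi>[of "t + \<epsilon>"]
    by (simp add: image_image add.assoc)
  have \<psi>\<phi>: "map (\<psi> \<circ> \<phi>) ` K t \<subseteq> K (t + 2 * \<epsilon>)" for t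
    using image_mono[OF \<phi>[of t], of "map \<psi>"] \<psi>[of "t + \<epsilon>"]
    by (simp add: image_image add.assoc)
  let ?P = "OT_persistence_module K k :: ('f, ('x list \<Rightarrow>\<^sub>0 'f) set) persistence"
  let ?Q = "OT_persistence_module L k :: ('f, ('y list \<Rightarrow>\<^sub>0 'f) set) persistence"
  let ?\<alpha> = "\<lambda>t. homology_map (L (t + \<epsilon>)) k \<phi> :: ('x list \<Rightarrow>\<^sub>0 'f) set \<Rightarrow> _"
  let ?\<beta> = "\<lambda>t. homology_map (K (t + \<epsilon>)) k \<psi> :: ('y list \<Rightarrow>\<^sub>0 'f) set \<Rightarrow> _"
  have two: "s + \<epsilon> + \<epsilon> = s + 2 * \<epsilon>" for s by simp
  \<comment> \<open>Both sides equal the map induced by \<phi> from level \<open>t\<close> to level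
    \<open>t' + \<epsilon>\<close>.\<close>
  have nat_\<alpha>: "?\<alpha> t' (pers_map ?P t t' A) = pers_map ?Q (t + \<epsilon>) (t' + \<epsilon>) (?\<alpha> t A)"
    if "t \<le> t'" "A \<in> carrier (pers_space ?P t)" for t t' A
    using that homology_map_comp[OF K_sub \<phi>, of t t' A k]
      homology_map_comp[OF \<phi> L_sub, of t "t' + \<epsilon>" A k] by simp
  have nat_\<beta>: "?\<beta> t' (pers_map ?Q t t' A) = pers_map ?P (t + \<epsilon>) (t' + \<epsilon>) (?\<beta> t A)"
    if "t \<le> t'" "A \<in> carrier (pers_space ?Q t)" for t t' A
    using that homology_map_comp[OF L_sub \<psi>, of t t' A k]
      homology_map_comp[OF \<psi> K_sub, of t "t' + \<epsilon>" A k] by simp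
  have \<beta>\<alpha>: "?\<beta> (t + \<epsilon>) (?\<alpha> t A) = pers_map ?P t (t + 2 * \<epsilon>) A"
    if A: "A \<in> carrier (pers_space ?P t)" for t A
  proof -
    have "?\<beta> (t + \<epsilon>) (?\<alpha> t A) = homology_map (K (t + 2 * \<epsilon>)) k (\<psi> \<circ> \<phi>) A"
      using homology_map_comp[OF \<phi> \<psi>, of A t k] A by (simp add: two)
    also have "\<dots> = homology_map (K (t + 2 * \<epsilon>)) k id A"
      using K_sub[of t "t + 2 * \<epsilon>"] A assms(3)
      by (intro homology_map_eq_id[OF \<psi>\<phi> _ prism_K]) auto
    finally show ?thesis by simp
  qed
  have \<alpha>\<beta>: "?\<alpha> (t + \<epsilon>) (?\<beta> t A) = pers_map ?Q t (t + 2 * \<epsilon>) A"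
    if A: "A \<in> carrier (pers_space ?Q t)" for t A
  proof -
    have "?\<alpha> (t + \<epsilon>) (?\<beta> t A) = homology_map (L (t + 2 * \<epsilon>)) k (\<phi> \<circ> \<psi>) A"
      using homology_map_comp[OF \<psi> \<phi>, of A t k] A by (simp add: two)
    also have "\<dots> = homology_map (L (t + 2 * \<epsilon>)) k id A"
      using L_sub[of t "t + 2 * \<epsilon>"] A assms(3)
      by (intro homology_map_eq_id[OF \<phi>\<psi> _ prism_L]) auto
    finally show ?thesis by simp
  qed
  have lin_\<alpha>: "linear_map class_ring (pers_space ?P t) (pers_space ?Q (t + \<epsilon>)) (?\<alpha> t)" for t
    using linear_map_homology_map[OF \<phi>] by simp
  have lin_\<beta>: "linear_map class_ring (pers_space ?Q t) (pers_space ?P (t + \<epsilon>)) (?\<beta> t)" for t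
    using linear_map_homology_map[OF \<psi>] by simp
  show ?thesis
    unfolding interleaved_def
    by (intro conjI persistence_module_OT mono exI[of _ ?\<alpha>] exI[of _ ?\<beta>] allI impI ballI
        lin_\<alpha> lin_\<beta> nat_\<alpha> nat_\<beta> \<beta>\<alpha> \<alpha>\<beta>)
qed


section \<open>The preorder filtration\<close>

lemma path_rel_map:
  assumes "(x, y) \<in> path_rel D"
    and "\<And>x. x \<in> pverts D \<Longrightarrow> \<phi> x \<in> pverts E"
    and "\<And>x y. (x, y) \<in> parcs D \<Longrightarrow> (\<phi> x, \<phi> y) \<in> parcs E"
  shows "(\<phi> x, \<phi> y) \<in> path_rel E"
proof -
  have arcs: "vwalk_arcs (map \<phi> p) = map (\<lambda>(x, y). (\<phi> x, \<phi> y)) (vwalk_arcs p)" for p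
    by (induction p rule: vwalk_arcs.induct) auto
  obtain p where "set p \<subseteq> pverts D" "set (vwalk_arcs p) \<subseteq> parcs D" "p \<noteq> []" "hd p = x" "last p = y"
    using assms(1) by (auto simp: path_rel_iff)
  with assms(2,3) show ?thesis
    unfolding path_rel_iff
    by (intro exI[of _ "map \<phi> p"]) (auto simp: arcs hd_map last_map)
qed

lemma arc_imp_path_rel:
  assumes "x \<in> pverts D" "y \<in> pverts D" "(x, y) \<in> parcs D"
  shows "(x, y) \<in> path_rel D"
  unfolding path_rel_iff using assms by (intro exI[of _ "[x, y]"]) simp

text \<open>A prism tuple follows \<open>v\<close> up to some entry \<open>a\<close>, steps from
  \<open>a\<close> to \<open>h a\<close>, and then follows \<open>map h v\<close>; each consecutive
  pair is related by one of the hypotheses. The clauses \<open>hd w = hd v\<close> and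
  \<open>v \<noteq> []\<close> strengthen the induction: prepending \<open>a\<close> requires that
  \<open>a\<close> be related to the head of the shorter tuple.\<close>

lemma keys_tuple_prism:
  assumes "\<And>a. a \<in> set v \<Longrightarrow> a \<in> X \<and> h a \<in> X \<and> (a, h a) \<in> r"
    and "successively (\<lambda>x y. (x, y) \<in> r) v" "successively (\<lambda>x y. (x, y) \<in> r) (map h v)"
    and "w \<in> Poly_Mapping.keys (tuple_prism h v :: 'x list \<Rightarrow>\<^sub>0 'f::field)"
  shows "w \<in> preorder_complex X r \<and> length w = Suc (length v) \<and> hd w = hd v \<and> v \<noteq> []"
  using assms
proof (induction v arbitrary: w)
  case (Cons a v)
  have "w \<in> Poly_Mapping.keys (basis_vec (a # h a # map h v) :: 'x list \<Rightarrow>\<^sub>0 'f)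
      \<union> Poly_Mapping.keys (cons_chain a (tuple_prism h v :: 'x list \<Rightarrow>\<^sub>0 'f))"
    using Cons.prems(4) keys_diff by fastforce
  then consider "w = a # h a # map h v"
    | w' where "w = a # w'" "w' \<in> Poly_Mapping.keys (tuple_prism h v :: 'x list \<Rightarrow>\<^sub>0 'f)"
    using keys_lin_map[of "cons_chain a" "tuple_prism h v :: 'x list \<Rightarrow>\<^sub>0 'f"] by auto
  then show ?case
  proof cases
    case 1
    with Cons.prems show ?thesis
      by (auto simp: preorder_complex_def successively_Cons)
  next
    case 2
    then have "w' \<in> preorder_complex X r \<and> length w' = Suc (length v) \<and> hd w' = hd v \<and> v \<noteq> []"
      using Cons.prems by (intro Cons.IH) (auto simp: successively_Cons)
    with 2 Cons.prems show ?thesis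
      by (auto simp: preorder_complex_def successively_Cons)
  qed
qed simp

text \<open>An arc at level \<open>t\<close> bounds three values of \<open>f\<close>, each of which
  rises by at most \<epsilon> under \<phi>. Hence arcs go to arcs, paths to paths and chains to
  chains at level \<open>t + \<epsilon>\<close>.\<close>

lemma preorder_filtration_map:
  assumes \<phi>: "\<And>x. x \<in> X \<Longrightarrow> \<phi> x \<in> Y"
    and le: "\<And>x y. x \<in> X \<Longrightarrow> y \<in> X \<Longrightarrow> g (\<phi> x) (\<phi> y) \<le> f x y + \<epsilon>"
  shows "map \<phi> ` preorder_filtration X f t \<subseteq> preorder_filtration Y g (t + \<epsilon>)"
proof -
  have verts: "\<phi> x \<in> sublevel Y g (t + \<epsilon>)" if "x \<in> sublevel X f t" for x
    using that \<phi> le[of x x] by (fastforce simp: sublevel_def)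
  have "(\<phi> x, \<phi> y) \<in> path_rel (digraph_filtration Y g (t + \<epsilon>))"
    if "(x, y) \<in> path_rel (digraph_filtration X f t)" for x y
  proof (rule path_rel_map[OF that])
    fix x y assume "(x, y) \<in> parcs (digraph_filtration X f t)"
    then show "(\<phi> x, \<phi> y) \<in> parcs (digraph_filtration Y g (t + \<epsilon>))"
      using \<phi> le[of x x] le[of x y] le[of y y] by (auto simp: digraph_filtration_def)
  qed (use verts in \<open>simp add: digraph_filtration_def\<close>)
  with verts show ?thesis
    by (auto simp: preorder_filtration_def preorder_complex_def successively_map subset_eq
        elim!: successively_mono)
qed

lemma keys_tuple_prism_preorder_filtration:
  assumes h: "\<And>x. x \<in> X \<Longrightarrow> h x \<in> X"
    and le: "\<And>x y. x \<in> X \<Longrightarrow> y \<in> X \<Longrightarrow> f (h x) (h y) \<le> f x y + \<delta>"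
    and near: "\<And>x. x \<in> X \<Longrightarrow> f x (h x) \<le> f x x + \<delta>" and "0 \<le> \<delta>"
    and v: "v \<in> preorder_filtration X f t"
  shows "Poly_Mapping.keys (tuple_prism h v :: 'x list \<Rightarrow>\<^sub>0 'f::field)
    \<subseteq> {w \<in> preorder_filtration X f (t + \<delta>). length w = Suc (length v)}"
proof -
  let ?S = "sublevel X f (t + \<delta>)" and ?D = "digraph_filtration X f (t + \<delta>)"
  have v': "v \<in> preorder_filtration X f (t + \<delta>)"
    using monoD[OF mono_preorder_filtration, of t "t + \<delta>" X f] v assms(4) by auto
  have hv: "map h v \<in> preorder_filtration X f (t + \<delta>)"
    using preorder_filtration_map[of X h X f f \<delta> t] h le v by auto
  have "a \<in> ?S \<and> h a \<in> ?S \<and> (a, h a) \<in> path_rel ?D" if "a \<in> set v" for a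
  proof -
    have a: "a \<in> X" "f a a \<le> t"
      using that v by (auto simp: preorder_filtration_def preorder_complex_def sublevel_def)
    \<comment> \<open>The single arc from \<open>a\<close> to \<open>h a\<close> is present:
      \<open>f a a\<close>, \<open>f (h a) (h a)\<close> and \<open>f a (h a)\<close> are all at
      most \<open>t + \<delta>\<close>, since \<open>f a a \<le> t\<close>.\<close>
    with h le[of a a] near[of a] assms(4) show ?thesis
      by (auto simp: sublevel_def digraph_filtration_def intro!: arc_imp_path_rel)
  qed
  then show ?thesis
    using v' hv keys_tuple_prism[of v ?S h "path_rel ?D"]
    by (auto simp: preorder_filtration_def preorder_complex_def)
qed

lemma interleaved_preorder_filtrations:
  fixes X :: "'x set" and Y :: "'y set"
  assumes M: "correspondence X Y M" and "0 \<le> \<epsilon>"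
    and dis: "\<And>x1 y1 x2 y2. (x1, y1) \<in> M \<Longrightarrow> (x2, y2) \<in> M \<Longrightarrow> \<bar>f x1 x2 - g y1 y2\<bar> \<le> \<epsilon>"
  shows "interleaved \<epsilon>
    (OT_persistence_module (preorder_filtration X f) k :: ('f::field, ('x list \<Rightarrow>\<^sub>0 'f) set) persistence)
    (OT_persistence_module (preorder_filtration Y g) k)"
proof -
  obtain \<phi> where \<phi>: "\<phi> x \<in> Y" "(x, \<phi> x) \<in> M" if "x \<in> X" for x
    using M unfolding correspondence_def by metis
  obtain \<psi> where \<psi>: "\<psi> y \<in> X" "(\<psi> y, y) \<in> M" if "y \<in> Y" for y
    using M unfolding correspondence_def by metis
  have \<phi>_le: "g (\<phi> x) (\<phi> y) \<le> f x y + \<epsilon>" if "x \<in> X" "y \<in> X" for x y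
    using dis[OF \<phi>(2) \<phi>(2), of x y] that by (simp add: abs_le_iff)
  have \<psi>_le: "f (\<psi> x) (\<psi> y) \<le> g x y + \<epsilon>" if "x \<in> Y" "y \<in> Y" for x y
    using dis[OF \<psi>(2) \<psi>(2), of x y] that by (simp add: abs_le_iff)
  \<comment> \<open>The intermediate value is \<open>g (\<phi> x) (\<phi> x)\<close>. It lies within
    \<epsilon> of \<open>f x (\<psi> (\<phi> x))\<close> and within \<epsilon> of
    \<open>f x x\<close>, since \<open>x\<close> and \<open>\<psi> (\<phi> x)\<close> are both
    matched with \<open>\<phi> x\<close>.\<close>
  have near_X: "f x (\<psi> (\<phi> x)) \<le> f x x + 2 * \<epsilon>" if "x \<in> X" for x
    using dis[OF \<phi>(2)[of x] \<psi>(2)[of "\<phi> x"]] dis[OF \<phi>(2)[of x] \<phi>(2)[of x]] that \<phi>(1)[OF that]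
    by (simp add: abs_le_iff)
  have near_Y: "g y (\<phi> (\<psi> y)) \<le> g y y + 2 * \<epsilon>" if "y \<in> Y" for y
    using dis[OF \<psi>(2)[of y] \<phi>(2)[of "\<psi> y"]] dis[OF \<psi>(2)[of y] \<psi>(2)[of y]] that \<psi>(1)[OF that]
    by (simp add: abs_le_iff)
  show ?thesis
  proof (rule interleaved_OT[OF mono_preorder_filtration mono_preorder_filtration \<open>0 \<le> \<epsilon>\<close>])
    show "map \<phi> ` preorder_filtration X f t \<subseteq> preorder_filtration Y g (t + \<epsilon>)" for t
      by (intro preorder_filtration_map \<phi>(1) \<phi>_le)
    show "map \<psi> ` preorder_filtration Y g t \<subseteq> preorder_filtration X f (t + \<epsilon>)" for t
      by (intro preorder_filtration_map \<psi>(1) \<psi>_le)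
    show "Poly_Mapping.keys (tuple_prism (\<psi> \<circ> \<phi>) v :: 'x list \<Rightarrow>\<^sub>0 'f)
        \<subseteq> {w \<in> preorder_filtration X f (t + 2 * \<epsilon>). length w = Suc (length v)}"
      if "v \<in> preorder_filtration X f t" for t v
    proof (rule keys_tuple_prism_preorder_filtration[OF _ _ _ _ that])
      show "f ((\<psi> \<circ> \<phi>) x) ((\<psi> \<circ> \<phi>) y) \<le> f x y + 2 * \<epsilon>" if "x \<in> X" "y \<in> X" for x y
        using \<phi>_le[OF that] \<psi>_le[OF that[THEN \<phi>(1)]] by simp
    qed (use \<phi> \<psi> near_X \<open>0 \<le> \<epsilon>\<close> in auto)
    show "Poly_Mapping.keys (tuple_prism (\<phi> \<circ> \<psi>) v :: 'y list \<Rightarrow>\<^sub>0 'f)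
        \<subseteq> {w \<in> preorder_filtration Y g (t + 2 * \<epsilon>). length w = Suc (length v)}"
      if "v \<in> preorder_filtration Y g t" for t v
    proof (rule keys_tuple_prism_preorder_filtration[OF _ _ _ _ that])
      show "g ((\<phi> \<circ> \<psi>) x) ((\<phi> \<circ> \<psi>) y) \<le> g x y + 2 * \<epsilon>" if "x \<in> Y" "y \<in> Y" for x y
        using \<psi>_le[OF that] \<phi>_le[OF that[THEN \<psi>(1)]] by simp
    qed (use \<phi> \<psi> near_Y \<open>0 \<le> \<epsilon>\<close> in auto)
  qed
qed

theorem theorem32:
  fixes X :: "'x set" and f :: "'x \<Rightarrow> 'x \<Rightarrow> real"
    and Y :: "'y set" and g :: "'y \<Rightarrow> 'y \<Rightarrow> real"
    and k :: nat
    and PX :: "('f::field, ('x list \<Rightarrow>\<^sub>0 'f) set) persistence"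
    and PY :: "('f, ('y list \<Rightarrow>\<^sub>0 'f) set) persistence"
  assumes "PX = OT_persistence_module (preorder_filtration X f) k"
    and "PY = OT_persistence_module (preorder_filtration Y g) k"
  shows "d_int PX PY \<le> 2 * d_CD X f Y g"
proof -
  have bound: "d_int PX PY \<le> distortion f g M" if M: "correspondence X Y M" for M
  \<comment> \<open>\<open>d_int\<close> ranges over positive \<epsilon> only, while the distortion
    may be 0. Taking an arbitrary \<open>e\<close> strictly above the distortion yields a positive
    real \<epsilon>, unless \<open>e\<close> is infinite and the bound is trivial.\<close>
  proof (rule dense_ge)
    fix e assume e: "distortion f g M < e"
    show "d_int PX PY \<le> e"
    proof (cases e)
      case (real \<epsilon>)
      have "0 < \<epsilon>" using e real by (metis ennreal_0 less_le not_less_zero)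
      have "\<bar>f x1 x2 - g y1 y2\<bar> \<le> \<epsilon>" if "(x1, y1) \<in> M" "(x2, y2) \<in> M" for x1 y1 x2 y2
      proof -
        have "ennreal \<bar>f x1 x2 - g y1 y2\<bar> \<le> distortion f g M"
          unfolding distortion_def
          by (rule SUP_upper2[of "((x1, y1), (x2, y2))"]) (use that in auto)
        also have "\<dots> \<le> ennreal \<epsilon>" using e real by simp
        finally show ?thesis using real by (simp add: ennreal_le_iff)
      qed
      then have "interleaved \<epsilon> PX PY"
        unfolding assms using M real by (intro interleaved_preorder_filtrations) auto
      with real \<open>0 < \<epsilon>\<close> show ?thesis
        unfolding d_int_def by (intro Inf_lower) blast
    qed simp
  qed
  \<comment> \<open>The factor 2 cancels the half in \<open>d_CD\<close> and leaves the plain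
    infimum, for which \<open>bound\<close> suffices. If there is no correspondence, the infimum is
    infinite and the inequality still holds.\<close>
  have "2 * d_CD X f Y g = (2 * (1 / 2)) * (INF M \<in> {M. correspondence X Y M}. distortion f g M)"
    by (simp only: d_CD_def mult.assoc)
  also have "2 * (1 / 2) = (1 :: ennreal)"
    by (simp add: ennreal_times_divide)
  finally show ?thesis
    using bound by (auto intro: INF_greatest)
qed

end
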